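(* Let $X\subset\mathbb{TC}$ be a nonempty compact set of the form $$X=(X_{\gamma_1\gamma_3}\times_{\gamma_1}X_{\overline{\gamma}_1\gamma_3})\times_{\gamma_3}(X_{\gamma_1\overline{\gamma}_3}\times_{\gamma_1}X_{\overline{\gamma}_1\overline{\gamma}_3}),$$ where $X_\gamma\subset\mathbb{C}(\mathbf{i_1})$ for each $\gamma\in S_{1,3}$. Then, for every $\eta=\sum_{\gamma\in S_{1,3}}\eta_\gamma\gamma\in\mathbb{TC}\setminus X$, $$d(\eta,X)=\sqrt{\frac{\sum_{\gamma\in S_{1,3}}d(\eta_\gamma,X_\gamma)^2}{4}}.$$
   Context: $\mathbb{TC}$ (tricomplex numbers) is the commutative unital real algebra generated by commuting units $\mathbf{i_1},\mathbf{i_2},\mathbf{i_3}$ with $\mathbf{i_1}^2=\mathbf{i_2}^2=\mathbf{i_3}^2=-1$; it has real dimension 8 with basis $1,\mathbf{i_1},\mathbf{i_2},\mathbf{i_3},\mathbf{i_4}=\mathbf{i_1}\mathbf{i_2}\mathbf{i_3},\mathbf{j_1}=\mathbf{i_1}\mathbf{i_2},\mathbf{j_2}=\mathbf{i_1}\mathbf{i_3},\mathbf{j_3}=\mathbf{i_2}\mathbf{i_3}$. $\|\cdot\|_3$ is the Euclidean norm of $\mathbb{R}^8$ with respect to this basis. $\mathbb{C}(\mathbf{i_1})=\{x+y\mathbf{i_1}:x,y\in\mathbb{R}\}$ is identified with the complex numbers, with usual modulus $|\cdot|$. $\mathbb{BC}=\{z_1+z_2\mathbf{i_2}: z_1,z_2\in\mathbb{C}(\mathbf{i_1})\}$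 is the subalgebra of bicomplex numbers. Put $\gamma_1=\frac{1+\mathbf{j_1}}{2}$, $\overline{\gamma}_1=\frac{1-\mathbf{j_1}}{2}$, $\gamma_3=\frac{1+\mathbf{j_3}}{2}$, $\overline{\gamma}_3=\frac{1-\mathbf{j_3}}{2}$ and $S_{1,3}=\{\gamma_1\gamma_3,\overline{\gamma}_1\gamma_3,\gamma_1\overline{\gamma}_3,\overline{\gamma}_1\overline{\gamma}_3\}$ (four idempotents with sum 1 and pairwise products 0). Every $\eta\in\mathbb{TC}$ is uniquely written $\eta=\sum_{\gamma\in S_{1,3}}\eta_\gamma\gamma$ with $\eta_\gamma\in\mathbb{C}(\mathbf{i_1})$. For $A,B\subset\mathbb{C}(\mathbf{i_1})$, $A\times_{\gamma_1}B=\{a\gamma_1+b\overline{\gamma}_1:a\in A,b\in B\}\subset\mathbb{BC}$; for $A,B\subset\mathbb{BC}$, $A\times_{\gamma_3}B=\{a\gamma_3+b\overline{\gamma}_3:a\in A,b\in B\}\subset\mathbb{TC}$. Distances: $d(\eta,X)=\inf\{\|\zeta-\eta\|_3:\zeta\in X\}$ in $\mathbb{TC}$, and $d(z,Y)=\inf\{|w-z|:w\in Y\}$ for $z\in\mathbb{C}(\mathbf{i_1})$, $Y\subset\mathbb{C}(\mathbf{i_1})$. *)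

theory Defs
  imports "HOL-Analysis.Analysis"
begin

text \<open>
  A tricomplex number is stored by its four coefficients in \<open>\<complex>(i1)\<close>, that is,
  \<open>Tricomplex z1 z2 z3 z4\<close> stands for \<open>z1 + z2 i2 + z3 i3 + z4 j3\<close> with \<open>j3 = i2 i3\<close>.
  The imaginary unit of the type \<open>complex\<close> plays the role of \<open>i1\<close>.
\<close>

datatype tricomplex =
  Tricomplex (cf_1: complex) (cf_i2: complex) (cf_i3: complex) (cf_j3: complex)

lemma tricomplex_eq_iff:
  "x = y \<longleftrightarrow> cf_1 x = cf_1 y \<and> cf_i2 x = cf_i2 y \<and> cf_i3 x = cf_i3 y \<and> cf_j3 x = cf_j3 y"
  by (cases x; cases y) simp

instantiation tricomplex :: comm_ring_1
begin

definition "0 = Tricomplex 0 0 0 0"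

definition "1 = Tricomplex 1 0 0 0"

definition
  "x + y = Tricomplex (cf_1 x + cf_1 y) (cf_i2 x + cf_i2 y) (cf_i3 x + cf_i3 y) (cf_j3 x + cf_j3 y)"

definition
  "- x = Tricomplex (- cf_1 x) (- cf_i2 x) (- cf_i3 x) (- cf_j3 x)"

definition
  "x - y = Tricomplex (cf_1 x - cf_1 y) (cf_i2 x - cf_i2 y) (cf_i3 x - cf_i3 y) (cf_j3 x - cf_j3 y)"

text \<open>
  The \<open>\<complex>(i1)\<close>-bilinear extension of \<open>i2\<^sup>2 = i3\<^sup>2 = -1\<close>, \<open>i2 i3 = i3 i2 = j3\<close>, which force
  \<open>j3\<^sup>2 = 1\<close>, \<open>i2 j3 = - i3\<close> and \<open>i3 j3 = - i2\<close>.
\<close>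

definition
  "x * y = Tricomplex
    (cf_1 x * cf_1 y - cf_i2 x * cf_i2 y - cf_i3 x * cf_i3 y + cf_j3 x * cf_j3 y)
    (cf_1 x * cf_i2 y + cf_i2 x * cf_1 y - cf_i3 x * cf_j3 y - cf_j3 x * cf_i3 y)
    (cf_1 x * cf_i3 y + cf_i3 x * cf_1 y - cf_i2 x * cf_j3 y - cf_j3 x * cf_i2 y)
    (cf_1 x * cf_j3 y + cf_j3 x * cf_1 y + cf_i2 x * cf_i3 y + cf_i3 x * cf_i2 y)"

instance
  by standard
    (simp_all add: tricomplex_eq_iff zero_tricomplex_def one_tricomplex_def plus_tricomplex_def
      uminus_tricomplex_def minus_tricomplex_def times_tricomplex_def algebra_simps)

end

instantiation tricomplex :: real_algebra_1
begin

definition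
  "r *\<^sub>R x = Tricomplex (r *\<^sub>R cf_1 x) (r *\<^sub>R cf_i2 x) (r *\<^sub>R cf_i3 x) (r *\<^sub>R cf_j3 x)"

instance
  by standard
    (simp_all add: tricomplex_eq_iff plus_tricomplex_def times_tricomplex_def
      scaleR_tricomplex_def algebra_simps)

end

lemma cf_simps [simp]:
  "cf_1 0 = 0" "cf_i2 0 = 0" "cf_i3 0 = 0" "cf_j3 0 = 0"
  "cf_1 1 = 1" "cf_i2 1 = 0" "cf_i3 1 = 0" "cf_j3 1 = 0"
  "cf_1 (x + y) = cf_1 x + cf_1 y" "cf_i2 (x + y) = cf_i2 x + cf_i2 y"
  "cf_i3 (x + y) = cf_i3 x + cf_i3 y" "cf_j3 (x + y) = cf_j3 x + cf_j3 y"
  "cf_1 (- x) = - cf_1 x" "cf_i2 (- x) = - cf_i2 x"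
  "cf_i3 (- x) = - cf_i3 x" "cf_j3 (- x) = - cf_j3 x"
  "cf_1 (x - y) = cf_1 x - cf_1 y" "cf_i2 (x - y) = cf_i2 x - cf_i2 y"
  "cf_i3 (x - y) = cf_i3 x - cf_i3 y" "cf_j3 (x - y) = cf_j3 x - cf_j3 y"
  "cf_1 (r *\<^sub>R x) = r *\<^sub>R cf_1 x" "cf_i2 (r *\<^sub>R x) = r *\<^sub>R cf_i2 x"
  "cf_i3 (r *\<^sub>R x) = r *\<^sub>R cf_i3 x" "cf_j3 (r *\<^sub>R x) = r *\<^sub>R cf_j3 x"
  "cf_1 (x * y) = cf_1 x * cf_1 y - cf_i2 x * cf_i2 y - cf_i3 x * cf_i3 y + cf_j3 x * cf_j3 y"
  "cf_i2 (x * y) = cf_1 x * cf_i2 y + cf_i2 x * cf_1 y - cf_i3 x * cf_j3 y - cf_j3 x * cf_i3 y"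
  "cf_i3 (x * y) = cf_1 x * cf_i3 y + cf_i3 x * cf_1 y - cf_i2 x * cf_j3 y - cf_j3 x * cf_i2 y"
  "cf_j3 (x * y) = cf_1 x * cf_j3 y + cf_j3 x * cf_1 y + cf_i2 x * cf_i3 y + cf_i3 x * cf_i2 y"
  by (simp_all add: zero_tricomplex_def one_tricomplex_def plus_tricomplex_def
      uminus_tricomplex_def minus_tricomplex_def times_tricomplex_def scaleR_tricomplex_def)

definition tc_of_complex :: "complex \<Rightarrow> tricomplex" where
  "tc_of_complex z = Tricomplex z 0 0 0"

definition tc_i1 :: tricomplex where "tc_i1 = tc_of_complex \<i>"
definition tc_i2 :: tricomplex where "tc_i2 = Tricomplex 0 1 0 0"
definition tc_i3 :: tricomplex where "tc_i3 = Tricomplex 0 0 1 0"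
definition tc_i4 :: tricomplex where "tc_i4 = tc_i1 * tc_i2 * tc_i3"
definition tc_j1 :: tricomplex where "tc_j1 = tc_i1 * tc_i2"
definition tc_j2 :: tricomplex where "tc_j2 = tc_i1 * tc_i3"
definition tc_j3 :: tricomplex where "tc_j3 = tc_i2 * tc_i3"

lemmas tc_unit_defs =
  tc_of_complex_def tc_i1_def tc_i2_def tc_i3_def tc_i4_def tc_j1_def tc_j2_def tc_j3_def

lemma tc_units:
  "tc_i1 = Tricomplex \<i> 0 0 0" "tc_i2 = Tricomplex 0 1 0 0" "tc_i3 = Tricomplex 0 0 1 0"
  "tc_i4 = Tricomplex 0 0 0 \<i>" "tc_j1 = Tricomplex 0 \<i> 0 0" "tc_j2 = Tricomplex 0 0 \<i> 0"
  "tc_j3 = Tricomplex 0 0 0 1"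
  by (simp_all add: tricomplex_eq_iff tc_unit_defs)

lemma tc_units_square: "tc_i1 * tc_i1 = - 1" "tc_i2 * tc_i2 = - 1" "tc_i3 * tc_i3 = - 1"
  by (simp_all add: tricomplex_eq_iff tc_unit_defs)

text \<open>
  The instance below makes \<open>norm\<close> the Euclidean norm for the basis
  \<open>1, i1, i2, i3, i4, j1, j2, j3\<close>; \<open>dist\<close> and the topology are those induced by it.
\<close>

instantiation tricomplex :: real_inner
begin

definition
  "inner x y = inner (cf_1 x) (cf_1 y) + inner (cf_i2 x) (cf_i2 y)
    + inner (cf_i3 x) (cf_i3 y) + inner (cf_j3 x) (cf_j3 y)"

definition "norm (x::tricomplex) = sqrt (inner x x)"

definition "sgn (x::tricomplex) = x /\<^sub>R norm x"

definition "dist (x::tricomplex) y = norm (x - y)"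

definition [code del]:
  "(uniformity :: (tricomplex \<times> tricomplex) filter)
    = (INF e\<in>{0 <..}. principal {(x, y). dist x y < e})"

definition [code del]:
  "open (U :: tricomplex set) \<longleftrightarrow> (\<forall>x\<in>U. eventually (\<lambda>(x', y). x' = x \<longrightarrow> y \<in> U) uniformity)"

instance
proof
  fix x y z :: tricomplex and r :: real and U :: "tricomplex set"
  show "dist x y = norm (x - y)" by (rule dist_tricomplex_def)
  show "sgn x = x /\<^sub>R norm x" by (rule sgn_tricomplex_def)
  show "(uniformity :: (tricomplex \<times> tricomplex) filter)
    = (INF e\<in>{0 <..}. principal {(x, y). dist x y < e})"
    by (rule uniformity_tricomplex_def)
  show "open U \<longleftrightarrow> (\<forall>x\<in>U. eventually (\<lambda>(x', y). x' = x \<longrightarrow> y \<in> U) uniformity)"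
    by (rule open_tricomplex_def)
  show "inner x y = inner y x"
    by (simp add: inner_tricomplex_def inner_commute)
  show "inner (x + y) z = inner x z + inner y z"
    by (simp add: inner_tricomplex_def inner_add_left)
  show "inner (r *\<^sub>R x) y = r * inner x y"
    by (simp add: inner_tricomplex_def distrib_left)
  show "0 \<le> inner x x"
    by (simp add: inner_tricomplex_def)
  show "inner x x = 0 \<longleftrightarrow> x = 0"
    by (simp add: inner_tricomplex_def tricomplex_eq_iff add_nonneg_eq_0_iff)
  show "norm x = sqrt (inner x x)" by (rule norm_tricomplex_def)
qed

end

instantiation tricomplex :: euclidean_space
begin

definition "Basis = {1, tc_i1, tc_i2, tc_i3, tc_i4, tc_j1, tc_j2, tc_j3}"

instance
proof
  show "(Basis :: tricomplex set) \<noteq> {}" and "finite (Basis :: tricomplex set)"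
    by (simp_all add: Basis_tricomplex_def)
next
  fix u v :: tricomplex
  assume "u \<in> Basis" "v \<in> Basis"
  then show "inner u v = (if u = v then 1 else 0)"
    unfolding Basis_tricomplex_def tc_units one_tricomplex_def
    by (elim insertE emptyE; hypsubst) (simp_all add: inner_tricomplex_def complex_eq_iff)
next
  fix x :: tricomplex
  show "(\<forall>u\<in>Basis. inner x u = 0) \<longleftrightarrow> x = 0"
    unfolding Basis_tricomplex_def ball_simps tc_units one_tricomplex_def
    by (auto simp: inner_tricomplex_def tricomplex_eq_iff inner_complex_def complex_eq_iff)
qed

end

lemma DIM_tricomplex: "DIM(tricomplex) = 8"
  by (simp add: Basis_tricomplex_def tc_units one_tricomplex_def)

lemma norm_tricomplex_basis:
  "norm (a0 *\<^sub>R 1 + a1 *\<^sub>R tc_i1 + a2 *\<^sub>R tc_i2 + a3 *\<^sub>R tc_i3 + a4 *\<^sub>R tc_i4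
      + b1 *\<^sub>R tc_j1 + b2 *\<^sub>R tc_j2 + b3 *\<^sub>R tc_j3)
    = sqrt (a0\<^sup>2 + a1\<^sup>2 + a2\<^sup>2 + a3\<^sup>2 + a4\<^sup>2 + b1\<^sup>2 + b2\<^sup>2 + b3\<^sup>2)"
  by (simp add: norm_tricomplex_def inner_tricomplex_def tc_unit_defs inner_complex_def
      power2_eq_square)

lemma tc_of_complex_Complex: "tc_of_complex (Complex x y) = of_real x + of_real y * tc_i1"
  by (simp add: tricomplex_eq_iff tc_unit_defs of_real_def complex_eq_iff)

lemma norm_tc_of_complex: "norm (tc_of_complex z) = cmod z"
  by (simp add: norm_tricomplex_def inner_tricomplex_def tc_of_complex_def norm_eq_sqrt_inner)

lemma tc_of_complex_ring_hom:
  "tc_of_complex 0 = 0" "tc_of_complex 1 = 1"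
  "tc_of_complex (z + w) = tc_of_complex z + tc_of_complex w"
  "tc_of_complex (z * w) = tc_of_complex z * tc_of_complex w"
  by (simp_all add: tricomplex_eq_iff tc_of_complex_def)

definition bicomplex :: "tricomplex set" where
  "bicomplex = {tc_of_complex z1 + tc_of_complex z2 * tc_i2 | z1 z2. True}"

definition gamma1 :: tricomplex where "gamma1 = (1 + tc_j1) /\<^sub>R 2"
definition gamma1_bar :: tricomplex where "gamma1_bar = (1 - tc_j1) /\<^sub>R 2"
definition gamma3 :: tricomplex where "gamma3 = (1 + tc_j3) /\<^sub>R 2"
definition gamma3_bar :: tricomplex where "gamma3_bar = (1 - tc_j3) /\<^sub>R 2"

lemmas gamma_defs = gamma1_def gamma1_bar_def gamma3_def gamma3_bar_def

lemma gamma_coefficients: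
  "gamma1 = Tricomplex (1/2) (\<i>/2) 0 0" "gamma1_bar = Tricomplex (1/2) (-\<i>/2) 0 0"
  "gamma3 = Tricomplex (1/2) 0 0 (1/2)" "gamma3_bar = Tricomplex (1/2) 0 0 (-1/2)"
  by (simp_all add: gamma_defs tricomplex_eq_iff tc_units complex_eq_iff)

definition S13 :: "tricomplex set" where
  "S13 = {gamma1 * gamma3, gamma1_bar * gamma3, gamma1 * gamma3_bar, gamma1_bar * gamma3_bar}"

definition times_gamma1 :: "complex set \<Rightarrow> complex set \<Rightarrow> tricomplex set"
    (infixl \<open>\<times>\<^sub>\<gamma>\<^sub>1\<close> 70) where
  "A \<times>\<^sub>\<gamma>\<^sub>1 B = {tc_of_complex a * gamma1 + tc_of_complex b * gamma1_bar | a b. a \<in> A \<and> b \<in> B}"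

text \<open>Intended for arguments contained in \<open>bicomplex\<close>.\<close>

definition times_gamma3 :: "tricomplex set \<Rightarrow> tricomplex set \<Rightarrow> tricomplex set"
    (infixl \<open>\<times>\<^sub>\<gamma>\<^sub>3\<close> 70) where
  "A \<times>\<^sub>\<gamma>\<^sub>3 B = {a * gamma3 + b * gamma3_bar | a b. a \<in> A \<and> b \<in> B}"

lemma times_gamma1_subset_bicomplex: "A \<times>\<^sub>\<gamma>\<^sub>1 B \<subseteq> bicomplex"
proof
  fix x assume "x \<in> A \<times>\<^sub>\<gamma>\<^sub>1 B"
  then obtain a b where x: "x = tc_of_complex a * gamma1 + tc_of_complex b * gamma1_bar"
    by (auto simp: times_gamma1_def)
  have "x = tc_of_complex ((a + b) / 2) + tc_of_complex (\<i> * (a - b) / 2) * tc_i2"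
    by (simp add: x tricomplex_eq_iff gamma_coefficients tc_units tc_of_complex_def
        complex_eq_iff field_simps)
  then show "x \<in> bicomplex" by (auto simp: bicomplex_def)
qed

lemma S13_elements:
  "gamma1 * gamma3 = Tricomplex (1/4) (\<i>/4) (-\<i>/4) (1/4)"
  "gamma1_bar * gamma3 = Tricomplex (1/4) (-\<i>/4) (\<i>/4) (1/4)"
  "gamma1 * gamma3_bar = Tricomplex (1/4) (\<i>/4) (\<i>/4) (-1/4)"
  "gamma1_bar * gamma3_bar = Tricomplex (1/4) (-\<i>/4) (-\<i>/4) (-1/4)"
  by (simp_all add: tricomplex_eq_iff gamma_coefficients)

lemma S13_distinct:
  "distinct [gamma1 * gamma3, gamma1_bar * gamma3, gamma1 * gamma3_bar, gamma1_bar * gamma3_bar]"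
  unfolding S13_elements by (simp add: complex_eq_iff)

lemma card_S13: "card S13 = 4"
  using distinct_card[OF S13_distinct] by (simp add: S13_def)

lemma sum_S13:
  "(\<Sum>\<gamma>\<in>S13. f \<gamma>) = f (gamma1 * gamma3) + f (gamma1_bar * gamma3)
    + f (gamma1 * gamma3_bar) + f (gamma1_bar * gamma3_bar)"
  using S13_distinct by (simp add: S13_def add.assoc)

lemma S13_idempotents:
  "(\<Sum>\<gamma>\<in>S13. \<gamma>) = 1"
  "\<gamma> \<in> S13 \<Longrightarrow> \<delta> \<in> S13 \<Longrightarrow> \<gamma> * \<delta> = (if \<gamma> = \<delta> then \<gamma> else 0)"
proof -
  show "(\<Sum>\<gamma>\<in>S13. \<gamma>) = 1"
    unfolding sum_S13 S13_elements by (simp add: tricomplex_eq_iff)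
  show "\<gamma> * \<delta> = (if \<gamma> = \<delta> then \<gamma> else 0)" if "\<gamma> \<in> S13" "\<delta> \<in> S13"
    using that unfolding S13_def S13_elements
    by (elim insertE emptyE; hypsubst)
      (simp_all add: times_tricomplex_def zero_tricomplex_def complex_eq_iff)
qed

lemma idempotent_decomposition:
  "\<exists>c. \<eta> = (\<Sum>\<gamma>\<in>S13. tc_of_complex (c \<gamma>) * \<gamma>)"
proof -
  obtain z1 z2 z3 z4 where \<eta>: "\<eta> = Tricomplex z1 z2 z3 z4" by (cases \<eta>)
  define c where "c = (\<lambda>_::tricomplex. 0::complex)
    (gamma1 * gamma3 := z1 - \<i> * z2 + \<i> * z3 + z4,
     gamma1_bar * gamma3 := z1 + \<i> * z2 - \<i> * z3 + z4,
     gamma1 * gamma3_bar := z1 - \<i> * z2 - \<i> * z3 - z4,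
     gamma1_bar * gamma3_bar := z1 + \<i> * z2 + \<i> * z3 - z4)"
  have c: "c (gamma1 * gamma3) = z1 - \<i> * z2 + \<i> * z3 + z4"
    "c (gamma1_bar * gamma3) = z1 + \<i> * z2 - \<i> * z3 + z4"
    "c (gamma1 * gamma3_bar) = z1 - \<i> * z2 - \<i> * z3 - z4"
    "c (gamma1_bar * gamma3_bar) = z1 + \<i> * z2 + \<i> * z3 - z4"
    using S13_distinct by (auto simp: c_def)
  have "\<eta> = (\<Sum>\<gamma>\<in>S13. tc_of_complex (c \<gamma>) * \<gamma>)"
    unfolding sum_S13 c unfolding S13_elements
    by (simp add: \<eta> tricomplex_eq_iff tc_of_complex_def complex_eq_iff field_simps)
  then show ?thesis by blast
qed

lemma tc_of_complex_mult_S13_cancel: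
  assumes "\<gamma> \<in> S13" "tc_of_complex z * \<gamma> = tc_of_complex w * \<gamma>"
  shows "z = w"
  using assms unfolding S13_def S13_elements
  by (auto simp: tricomplex_eq_iff tc_of_complex_def)

lemma idempotent_decomposition_unique:
  assumes "(\<Sum>\<gamma>\<in>S13. tc_of_complex (c \<gamma>) * \<gamma>) = (\<Sum>\<gamma>\<in>S13. tc_of_complex (d \<gamma>) * \<gamma>)"
    and "\<delta> \<in> S13"
  shows "c \<delta> = d \<delta>"
proof -
  have fin: "finite S13" by (simp add: S13_def)
  have *: "(\<Sum>\<gamma>\<in>S13. tc_of_complex (f \<gamma>) * \<gamma>) * \<delta> = tc_of_complex (f \<delta>) * \<delta>" for f
  proof -
    have "(\<Sum>\<gamma>\<in>S13. tc_of_complex (f \<gamma>) * \<gamma>) * \<delta>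
      = (\<Sum>\<gamma>\<in>S13. if \<gamma> = \<delta> then tc_of_complex (f \<delta>) * \<delta> else 0)"
      unfolding sum_distrib_right
      by (rule sum.cong) (use assms(2) in \<open>auto simp: mult.assoc S13_idempotents(2)\<close>)
    then show ?thesis using fin assms(2) by simp
  qed
  show ?thesis
    using tc_of_complex_mult_S13_cancel[OF assms(2)] *[of c] *[of d] assms(1) by simp
qed

end

theory Submission
  imports Defs
begin

text \<open>
  In idempotent coordinates the squared norm on \<open>\<real>\<^sup>8\<close> is a quarter of the sum of the squared
  moduli, and \<open>X\<close> is a product of four sets. The four coordinate distances can therefore be
  minimised independently; near-minimisers suffice, so no attainment argument is needed.
\<close>

text \<open>By \<open>S13_elements\<close>, the coefficient vectors of the four idempotents are
  pairwise orthogonal for the Hermitian product on the four complex coefficients, and each has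
  squared length 1/4. So all cross terms cancel.\<close>

lemma norm_idempotent_decomposition:
  "norm (\<Sum>\<gamma>\<in>S13. tc_of_complex (c \<gamma>) * \<gamma>) = sqrt ((\<Sum>\<gamma>\<in>S13. (cmod (c \<gamma>))\<^sup>2) / 4)"
proof -
  \<comment> \<open>Naming the four values keeps the arguments of \<open>c\<close> out of reach when
    \<open>S13_elements\<close> is unfolded below.\<close>
  define a b p q where "a = c (gamma1 * gamma3)" and "b = c (gamma1_bar * gamma3)"
    and "p = c (gamma1 * gamma3_bar)" and "q = c (gamma1_bar * gamma3_bar)"
  show ?thesis
    unfolding sum_S13 a_def[symmetric] b_def[symmetric] p_def[symmetric] q_def[symmetric]
    unfolding S13_elements norm_tricomplex_def inner_tricomplex_def real_sqrt_eq_iff cmod_power2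
    by (simp add: tc_of_complex_def inner_complex_def power2_eq_square field_simps)
qed

lemma dist_idempotent_decomposition:
  "dist (\<Sum>\<gamma>\<in>S13. tc_of_complex (c \<gamma>) * \<gamma>) (\<Sum>\<gamma>\<in>S13. tc_of_complex (d \<gamma>) * \<gamma>)
    = sqrt ((\<Sum>\<gamma>\<in>S13. (dist (c \<gamma>) (d \<gamma>))\<^sup>2) / 4)"
proof -
  have "tc_of_complex (c \<gamma>) * \<gamma> - tc_of_complex (d \<gamma>) * \<gamma> = tc_of_complex (c \<gamma> - d \<gamma>) * \<gamma>" for \<gamma>
    by (simp add: tricomplex_eq_iff tc_of_complex_def algebra_simps)
  then show ?thesis
    by (simp add: dist_norm flip: sum_subtractf norm_idempotent_decomposition)
qed

text \<open>Distributing over the outer idempotents turns the nested product into independent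
  choices of four coordinates, so membership is tested one coordinate at a time.\<close>

lemma idempotent_product_eq:
  "(A (gamma1 * gamma3) \<times>\<^sub>\<gamma>\<^sub>1 A (gamma1_bar * gamma3))
     \<times>\<^sub>\<gamma>\<^sub>3 (A (gamma1 * gamma3_bar) \<times>\<^sub>\<gamma>\<^sub>1 A (gamma1_bar * gamma3_bar))
   = {\<Sum>\<gamma>\<in>S13. tc_of_complex (d \<gamma>) * \<gamma> | d. \<forall>\<gamma>\<in>S13. d \<gamma> \<in> A \<gamma>}" (is "?L = ?R")
proof (rule set_eqI, rule iffI)
  fix x assume "x \<in> ?L"
  then obtain a b p q where
    A: "a \<in> A (gamma1 * gamma3)" "b \<in> A (gamma1_bar * gamma3)"
       "p \<in> A (gamma1 * gamma3_bar)" "q \<in> A (gamma1_bar * gamma3_bar)"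
    and x: "x = (tc_of_complex a * gamma1 + tc_of_complex b * gamma1_bar) * gamma3
              + (tc_of_complex p * gamma1 + tc_of_complex q * gamma1_bar) * gamma3_bar"
    by (auto simp: times_gamma1_def times_gamma3_def)
  \<comment> \<open>The default 0 is arbitrary, since only values on \<open>S13\<close> enter the
    sum. By \<open>S13_distinct\<close> no update overwrites another.\<close>
  define d where "d = (\<lambda>_::tricomplex. 0::complex)
    (gamma1 * gamma3 := a, gamma1_bar * gamma3 := b,
     gamma1 * gamma3_bar := p, gamma1_bar * gamma3_bar := q)"
  have d: "d (gamma1 * gamma3) = a" "d (gamma1_bar * gamma3) = b"
    "d (gamma1 * gamma3_bar) = p" "d (gamma1_bar * gamma3_bar) = q"
    using S13_distinct by (auto simp: d_def)
  have "x = (\<Sum>\<gamma>\<in>S13. tc_of_complex (d \<gamma>) * \<gamma>)"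
    unfolding sum_S13 d x by (simp only: distrib_right mult.assoc add.assoc)
  moreover have "\<forall>\<gamma>\<in>S13. d \<gamma> \<in> A \<gamma>"
    using A d by (simp add: S13_def)
  ultimately show "x \<in> ?R" by blast
next
  fix x assume "x \<in> ?R"
  then obtain d where d: "\<forall>\<gamma>\<in>S13. d \<gamma> \<in> A \<gamma>"
    and x: "x = (\<Sum>\<gamma>\<in>S13. tc_of_complex (d \<gamma>) * \<gamma>)" by blast
  have "x = (tc_of_complex (d (gamma1 * gamma3)) * gamma1
        + tc_of_complex (d (gamma1_bar * gamma3)) * gamma1_bar) * gamma3
      + (tc_of_complex (d (gamma1 * gamma3_bar)) * gamma1
        + tc_of_complex (d (gamma1_bar * gamma3_bar)) * gamma1_bar) * gamma3_bar"
    unfolding x sum_S13 by (simp only: distrib_right mult.assoc add.assoc)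
  with d show "x \<in> ?L"
    unfolding times_gamma1_def times_gamma3_def S13_def by blast
qed

text \<open>Otherwise \<open>infdist x A + e\<close> would be a lower bound of all the distances,
  larger than their infimum.\<close>

lemma infdist_almost_attained:
  assumes "A \<noteq> {}" "e > 0"
  shows "\<exists>a\<in>A. dist x a < infdist x A + e"
proof (rule ccontr)
  assume "\<not> ?thesis"
  then have "infdist x A + e \<le> (INF a\<in>A. dist x a)"
    using assms(1) by (intro cINF_greatest) (auto simp: not_less)
  then have "infdist x A + e \<le> infdist x A"
    using assms(1) by (simp add: infdist_notempty)
  with assms(2) show False by simp
qed

theorem theorem10:
  fixes X :: "tricomplex set"
    and Xc :: "tricomplex \<Rightarrow> complex set"
    and \<eta> :: tricomplex
    and \<eta>c :: "tricomplex \<Rightarrow> complex"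
  assumes "X \<noteq> {}"
    and "compact X"
    and "X = (Xc (gamma1 * gamma3) \<times>\<^sub>\<gamma>\<^sub>1 Xc (gamma1_bar * gamma3))
           \<times>\<^sub>\<gamma>\<^sub>3 (Xc (gamma1 * gamma3_bar) \<times>\<^sub>\<gamma>\<^sub>1 Xc (gamma1_bar * gamma3_bar))"
    and "\<eta> = (\<Sum>\<gamma>\<in>S13. tc_of_complex (\<eta>c \<gamma>) * \<gamma>)"
    and "\<eta> \<in> UNIV - X"
  shows "infdist \<eta> X = sqrt ((\<Sum>\<gamma>\<in>S13. (infdist (\<eta>c \<gamma>) (Xc \<gamma>))\<^sup>2) / 4)"
proof -
  have X: "X = {\<Sum>\<gamma>\<in>S13. tc_of_complex (d \<gamma>) * \<gamma> | d. \<forall>\<gamma>\<in>S13. d \<gamma> \<in> Xc \<gamma>}"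
    unfolding assms(3) by (rule idempotent_product_eq)
  \<comment> \<open>With one factor empty, no choice \<open>d\<close> would exist and
    \<open>X\<close> would be empty.\<close>
  have ne: "Xc \<gamma> \<noteq> {}" if "\<gamma> \<in> S13" for \<gamma>
    using assms(1) that unfolding X by blast
  \<comment> \<open>\<open>f e\<close> bounds the distance to a point chosen within slack
    \<open>e\<close> in every coordinate; \<open>f 0\<close> is the claimed value.\<close>
  define f where "f e = sqrt ((\<Sum>\<gamma>\<in>S13. (infdist (\<eta>c \<gamma>) (Xc \<gamma>) + e)\<^sup>2) / 4)" for e
  have upper: "infdist \<eta> X \<le> f e" if "e > 0" for e
  proof -
    have "\<forall>\<gamma>\<in>S13. \<exists>w. w \<in> Xc \<gamma> \<and> dist (\<eta>c \<gamma>) w < infdist (\<eta>c \<gamma>) (Xc \<gamma>) + e"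
      using infdist_almost_attained[OF ne that] by blast
    then obtain d where d: "\<forall>\<gamma>\<in>S13. d \<gamma> \<in> Xc \<gamma> \<and> dist (\<eta>c \<gamma>) (d \<gamma>) < infdist (\<eta>c \<gamma>) (Xc \<gamma>) + e"
      by metis
    then have "(\<Sum>\<gamma>\<in>S13. tc_of_complex (d \<gamma>) * \<gamma>) \<in> X"
      unfolding X by blast
    then have "infdist \<eta> X \<le> dist \<eta> (\<Sum>\<gamma>\<in>S13. tc_of_complex (d \<gamma>) * \<gamma>)"
      by (rule infdist_le)
    also have "\<dots> \<le> f e"
      unfolding assms(4) dist_idempotent_decomposition f_def
      using d by (intro real_sqrt_le_mono divide_right_mono sum_mono power_mono) (auto intro: less_imp_le)
    finally show ?thesis .
  qed
  \<comment> \<open>Continuity of \<open>f\<close> lets the slack tend to 0 in the upper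
    bound.\<close>
  have "(f \<longlongrightarrow> f 0) (at_right 0)"
    unfolding f_def by (intro tendsto_intros) simp_all
  moreover have "eventually (\<lambda>e. infdist \<eta> X \<le> f e) (at_right 0)"
    using upper by (auto simp: eventually_at_right_field intro: exI[of _ 1])
  ultimately have "infdist \<eta> X \<le> f 0"
    by (rule tendsto_lowerbound) simp
  \<comment> \<open>Conversely, each coordinate of a point of \<open>X\<close> lies in its
    \<open>Xc \<gamma>\<close>, so its distance is at least the corresponding
    \<open>infdist\<close>; squares, sum and root preserve this.\<close>
  moreover have "f 0 \<le> infdist \<eta> X"
    unfolding infdist_notempty[OF assms(1)]
  proof (rule cINF_greatest[OF assms(1)])
    fix x assume "x \<in> X"
    then obtain d where "\<forall>\<gamma>\<in>S13. d \<gamma> \<in> Xc \<gamma>" and x: "x = (\<Sum>\<gamma>\<in>S13. tc_of_complex (d \<gamma>) * \<gamma>)"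
      unfolding X by blast
    then show "f 0 \<le> dist \<eta> x"
      unfolding x assms(4) dist_idempotent_decomposition f_def
      by (intro real_sqrt_le_mono divide_right_mono sum_mono power_mono)
        (auto intro: infdist_le infdist_nonneg)
  qed
  ultimately show ?thesis by (simp add: f_def)
qed

end
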